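(* Let $N\ge2$, $1\le k<N$, $C=[0,\infty)^N$, and let $T:C\to C$ be given by $T_i(x)=x_if_i(x)$, $i=1,\dots,N$, where $f\in C^1(C,C)$ with $f_i(x)>0$ for all $x\in C$ and all $i$. Assume that the system $x(n)=T^n(x)$ is type-K competitive, that $f_i(\mathbf 0)>1$ for all $i$, and that the system is dissipative. Let $r\in\dot C$ be such that for each $x\in C$, $T^n(x)\in[\mathbf 0,r]$ for all large enough $n$. Assume moreover that $T([\mathbf 0,r])\subset[\mathbf 0,r)$ and that $T$ from $[\mathbf 0,r]$ to $T([\mathbf 0,r])$ is a homeomorphism and weakly type-K retrotone. Then: (a) The invariant compact set $\Sigma=\bigcap_{n=0}^\infty T^n([\mathbf 0,r]\setminus[\mathbf 0,q))$ satisfies $$\Sigma=\mathcal A\setminus\mathcal R(\mathbf 0)=\Sigma_H\cup\Sigma_0\cup\Sigma_V,$$ where $\Sigma_H=\{x\in\Sigma:\alpha(x)\subset(\Sigma\cap C_H)\}$, $\Sigma_V=\{x\in\Sigma:\alpha(x)\subset(\Sigma\cap C_V)\}$, $\Sigma_0=\Sigma\setminus(\Sigma_H\cup\Sigma_V)$, with $\Sigma_H\ne\emptyset$ and $\Sigma_V\neq\emptyset$. (b) The set $\mathcal R(\mathbf 0)$ is connected and type-K convex. (c) For any $x,y\in\mathcal A$ with $x<_K y$ and $I=\{m\in\{1,\dots,N\}:x_m\ne y_m\}$: if $i\in H\cap I$ then $\lim_{n\to\infty}[T^{-n}(x)]_i=0$, and if $j\in V\cap I$ then $\lim_{n\to\infty}[T^{-n}(y)]_j=0$.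 If in addition $T$ is type-K retrotone on $[\mathbf 0,r]$, conclusion (c) is replaced by: (d) For any $x,y\in\mathcal A$ with $x<_K y$, we have $\lim_{n\to\infty}[T^{-n}(x)]_H=\mathbf 0$ and $\lim_{n\to\infty}[T^{-n}(y)]_V=\mathbf 0$.
   Context: Notation: $\dot C=(0,\infty)^N$; $H=\{1,\dots,k\}$, $V=\{k+1,\dots,N\}$; $x\le y$ means $y-x\in C$, $x\ll y$ means $y-x\in\dot C$; $[\mathbf 0,r]=\{z\in C:z\le r\}$, $[\mathbf 0,r)=\{z\in C: z\ll r\}$. $C_H=\{x\in C:x_j=0\ \forall j\in V\}$, $C_V=\{x\in C:x_i=0\ \forall i\in H\}$; $x_H$ (or $[x]_H$) and $x_V$ are the projections of $x$ onto $C_H$ and $C_V$. $K=\{p\in\mathbb R^N:p_i\ge0\ \forall i\in H,\ p_j\le0\ \forall j\in V\}$; $x\le_K y$ means $y-x\in K$; $x<_K y$ means $x\le_K y$, $x\ne y$. The system is type-K competitive if for all $x\in C$ the Jacobian $Df(x)=(\partial f_i/\partial x_j)$ has block form $\begin{pmatrix}A_1 & B_1 \\ B_2 & A_2\end{pmatrix}$, where $A_1$ ($k\times k$) and $A_2$ ($(N-k)\times(N-k)$) have nonpositive entries with each diagonal entry negative, and $B_1,B_2$ have nonnegative entries. It is dissipative if there is a bounded $B\subset C$ such that for each $x\in C$, $T^n(x)\in B$ for all large enough $n$. $T$ is type-K retrotone on $X\subset C$ if for any $x,y\in X$, $T(x)<_K T(y)$ implies $x<_K y$ and, for each $i\in H$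 and $j\in V$, if $y_i\ne0$ then $x_i<y_i$, and if $x_j\ne0$ then $x_j>y_j$. $T$ is weakly type-K retrotone on $X$ if for any $x,y\in X$, $T(x)<_K T(y)$ implies $x<_K y$ and, for each $i\in H$ and $j\in V$, if $T_i(x)<T_i(y)$ then $x_i<y_i$, and if $T_j(x)>T_j(y)$ then $x_j>y_j$. $q$ is a point with $\mathbf 0\ll q\ll r$ such that $f_i(x)>1$ for all $i$ and all $x\in[\mathbf 0,q]$, $T([\mathbf 0,r]\setminus[\mathbf 0,q))\subset[\mathbf 0,r]\setminus[\mathbf 0,q)$ and $[\mathbf 0,q]\subset T([\mathbf 0,q])$ (such $q$ exists because $f_i(\mathbf 0)>1$ for all $i$). $\mathcal A=\bigcap_{n=0}^\infty T^n([\mathbf 0,r])$. $T^{-1}:T([\mathbf 0,r])\to[\mathbf 0,r]$ is the inverse of the homeomorphism $T|_{[\mathbf 0,r]}$ and $T^{-n}$ its iterates where defined (all are defined on $\mathcal A$). $\mathcal R(\mathbf 0)=\{x\in C:T^{-n}(x)\text{ is defined for all }n\text{ and }\lim_{n\to\infty}T^{-n}(x)=\mathbf 0\}$. For $x\in\mathcal A$, $\alpha(x)=\bigcap_{n\ge0}\overline{\{T^{-m}(x):m\ge n\}}$. A set $S$ is type-K convex if for any distinct $x,y\in S$ with $x<_K y$, the segment $\overline{xy}=\{tx+(1-t)y:0\le t\le1\}$ is contained in $S$. *)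

theory Defs
  imports "HOL-Analysis.Analysis"
begin

text \<open>
  The coordinate set is the type \<open>'n\<close>. It is split into a set \<open>H\<close> and its complement \<open>V = - H\<close>.
  The library order on \<open>real ^ 'n\<close> is componentwise, so \<open>{0..r}\<close> is the closed order interval
  from \<open>0\<close> to \<open>r\<close>.
\<close>

definition orthant :: "(real ^ 'n) set" where
  "orthant = {x. 0 \<le> x}"

definition strongly_less :: "real ^ 'n \<Rightarrow> real ^ 'n \<Rightarrow> bool"  (infix "\<lless>" 50) where
  "x \<lless> y \<longleftrightarrow> (\<forall>i. x $ i < y $ i)"

text \<open>This is \<open>[0, r)\<close>, relatively open in the orthant; it contains boundary points of the orthant,
  so it differs from the library's \<open>box 0 r\<close>.\<close>

definition lower_box :: "real ^ 'n \<Rightarrow> (real ^ 'n) set" where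
  "lower_box r = {z \<in> orthant. z \<lless> r}"

definition face :: "'n set \<Rightarrow> (real ^ 'n) set" where
  "face S = {x \<in> orthant. \<forall>j. j \<notin> S \<longrightarrow> x $ j = 0}"

definition face_proj :: "'n set \<Rightarrow> real ^ 'n \<Rightarrow> real ^ 'n" where
  "face_proj S x = (\<chi> i. if i \<in> S then x $ i else 0)"

definition cone_K :: "'n set \<Rightarrow> (real ^ 'n) set" where
  "cone_K H = {p. (\<forall>i\<in>H. 0 \<le> p $ i) \<and> (\<forall>j\<in>- H. p $ j \<le> 0)}"

definition le_K :: "'n set \<Rightarrow> real ^ 'n \<Rightarrow> real ^ 'n \<Rightarrow> bool" where
  "le_K H x y \<longleftrightarrow> y - x \<in> cone_K H"

definition less_K :: "'n set \<Rightarrow> real ^ 'n \<Rightarrow> real ^ 'n \<Rightarrow> bool" where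
  "less_K H x y \<longleftrightarrow> le_K H x y \<and> x \<noteq> y"

text \<open>Continuous differentiability on a set with Jacobian \<open>Df\<close>, where \<open>Df x $ i $ j\<close> is the partial
  derivative of the \<open>i\<close>-th component in direction \<open>j\<close>. Derivatives are taken within the set, hence
  one-sided at the boundary of the orthant.\<close>

definition C1_on :: "(real ^ 'n) set \<Rightarrow> (real ^ 'n \<Rightarrow> real ^ 'n) \<Rightarrow> (real ^ 'n \<Rightarrow> real ^ 'n ^ 'n) \<Rightarrow> bool"
  where
  "C1_on X f Df \<longleftrightarrow>
     (\<forall>x\<in>X. (f has_derivative (\<lambda>h. Df x *v h)) (at x within X)) \<and> continuous_on X Df"

definition typeK_competitive :: "'n set \<Rightarrow> (real ^ 'n \<Rightarrow> real ^ 'n ^ 'n) \<Rightarrow> bool" where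
  "typeK_competitive H Df \<longleftrightarrow>
     (\<forall>x\<in>orthant. \<forall>i j.
        (((i \<in> H) = (j \<in> H)) \<longrightarrow> Df x $ i $ j \<le> 0) \<and>
        (((i \<in> H) \<noteq> (j \<in> H)) \<longrightarrow> 0 \<le> Df x $ i $ j) \<and>
        Df x $ i $ i < 0)"

definition dissipative :: "(real ^ 'n \<Rightarrow> real ^ 'n) \<Rightarrow> bool" where
  "dissipative T \<longleftrightarrow>
     (\<exists>B. bounded B \<and> B \<subseteq> orthant \<and> (\<forall>x\<in>orthant. \<forall>\<^sub>F n in sequentially. (T ^^ n) x \<in> B))"

definition typeK_retrotone_on ::
  "'n set \<Rightarrow> (real ^ 'n) set \<Rightarrow> (real ^ 'n \<Rightarrow> real ^ 'n) \<Rightarrow> bool" where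
  "typeK_retrotone_on H X T \<longleftrightarrow>
     (\<forall>x\<in>X. \<forall>y\<in>X. less_K H (T x) (T y) \<longrightarrow>
        less_K H x y \<and>
        (\<forall>i\<in>H. \<forall>j\<in>- H. (y $ i \<noteq> 0 \<longrightarrow> x $ i < y $ i) \<and> (x $ j \<noteq> 0 \<longrightarrow> x $ j > y $ j)))"

definition weakly_typeK_retrotone_on ::
  "'n set \<Rightarrow> (real ^ 'n) set \<Rightarrow> (real ^ 'n \<Rightarrow> real ^ 'n) \<Rightarrow> bool" where
  "weakly_typeK_retrotone_on H X T \<longleftrightarrow>
     (\<forall>x\<in>X. \<forall>y\<in>X. less_K H (T x) (T y) \<longrightarrow>
        less_K H x y \<and>
        (\<forall>i\<in>H. \<forall>j\<in>- H. (T x $ i < T y $ i \<longrightarrow> x $ i < y $ i) \<and>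
                       (T x $ j > T y $ j \<longrightarrow> x $ j > y $ j)))"

definition typeK_convex :: "'n set \<Rightarrow> (real ^ 'n) set \<Rightarrow> bool" where
  "typeK_convex H S \<longleftrightarrow> (\<forall>x\<in>S. \<forall>y\<in>S. less_K H x y \<longrightarrow> closed_segment x y \<subseteq> S)"

definition attractor :: "(real ^ 'n \<Rightarrow> real ^ 'n) \<Rightarrow> real ^ 'n \<Rightarrow> (real ^ 'n) set" where
  "attractor T r = (\<Inter>n. (T ^^ n) ` {0..r})"

definition outer_set :: "(real ^ 'n \<Rightarrow> real ^ 'n) \<Rightarrow> real ^ 'n \<Rightarrow> real ^ 'n \<Rightarrow> (real ^ 'n) set" where
  "outer_set T r q = (\<Inter>n. (T ^^ n) ` ({0..r} - lower_box q))"

text \<open>The inverse of \<open>T\<close> restricted to \<open>{0..r}\<close>. Its values outside \<open>T ` {0..r}\<close> are meaningless;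
  all iterates at \<open>x\<close> are defined iff every one of them lies in \<open>T ` {0..r}\<close> again.\<close>

definition inv_step :: "(real ^ 'n \<Rightarrow> real ^ 'n) \<Rightarrow> real ^ 'n \<Rightarrow> real ^ 'n \<Rightarrow> real ^ 'n" where
  "inv_step T r = inv_into {0..r} T"

definition inv_steps_defined :: "(real ^ 'n \<Rightarrow> real ^ 'n) \<Rightarrow> real ^ 'n \<Rightarrow> real ^ 'n \<Rightarrow> bool" where
  "inv_steps_defined T r x \<longleftrightarrow> (\<forall>n. (inv_step T r ^^ n) x \<in> T ` {0..r})"

definition repulsion_set :: "(real ^ 'n \<Rightarrow> real ^ 'n) \<Rightarrow> real ^ 'n \<Rightarrow> (real ^ 'n) set" where
  "repulsion_set T r =
     {x \<in> orthant. inv_steps_defined T r x \<and> (\<lambda>n. (inv_step T r ^^ n) x) \<longlonglongrightarrow> 0}"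

definition alpha_limit :: "(real ^ 'n \<Rightarrow> real ^ 'n) \<Rightarrow> real ^ 'n \<Rightarrow> real ^ 'n \<Rightarrow> (real ^ 'n) set" where
  "alpha_limit T r x = (\<Inter>n. closure {(inv_step T r ^^ m) x | m. m \<ge> n})"

text \<open>The part of \<open>outer_set T r q\<close> whose alpha limit sets lie in \<open>face S\<close>.\<close>

definition outer_face ::
  "(real ^ 'n \<Rightarrow> real ^ 'n) \<Rightarrow> real ^ 'n \<Rightarrow> real ^ 'n \<Rightarrow> 'n set \<Rightarrow> (real ^ 'n) set" where
  "outer_face T r q S =
     {x \<in> outer_set T r q. alpha_limit T r x \<subseteq> outer_set T r q \<inter> face S}"

definition outer_mid ::
  "(real ^ 'n \<Rightarrow> real ^ 'n) \<Rightarrow> real ^ 'n \<Rightarrow> real ^ 'n \<Rightarrow> 'n set \<Rightarrow> (real ^ 'n) set" where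
  "outer_mid T r q H =
     outer_set T r q - (outer_face T r q H \<union> outer_face T r q (- H))"

end

theory Submission
  imports Defs
begin

text \<open>
  Write \<open>g\<close> for the inverse of \<open>T\<close> on \<open>X = [0, r]\<close>. On \<open>[0, q]\<close> all growth rates exceed \<open>1\<close>, so
  backward orbits decrease there to the only fixed point \<open>0\<close>; a backward orbit therefore either
  stays outside \<open>[0, q)\<close> forever or converges to \<open>0\<close>.

  For \<open>x \<le>\<^sub>K y\<close> in the attractor, the whole \<open>K\<close>-order interval \<open>[x, y]\<^sub>K\<close> lies in \<open>T(X)\<close>:
  its intersection with \<open>T(X)\<close> is closed, and it is open because \<open>g\<close> maps it
  between \<open>g x\<close> and \<open>g y\<close>, hence into \<open>[0, r)\<close>, whose image is relatively open by invariance of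
  domain. Iterating, \<open>[x, y]\<^sub>K\<close> lies in the attractor and backward orbits remain ordered. If both
  ends are repelled by \<open>0\<close>, so is everything in between.

  For \<open>i \<in> H\<close> the ratio \<open>[g\<^sup>n x]\<^sub>i / [g\<^sup>n y]\<^sub>i\<close> decreases in \<open>n\<close>, by competitiveness, and its decrements
  bound \<open>[g\<^sup>n x]\<^sub>i\<close> up to a constant. Exchanging \<open>H\<close> with \<open>V\<close> and \<open>x\<close> with \<open>y\<close> gives the statement for \<open>V\<close>.
\<close>

section \<open>Order preliminaries\<close>

lemma mem_orthant: "x \<in> orthant \<longleftrightarrow> (\<forall>i. 0 \<le> x $ i)"
  by (simp add: orthant_def less_eq_vec_def)

lemma mem_order_interval:
  fixes r :: "real ^ 'n"
  shows "x \<in> {0..r} \<longleftrightarrow> (\<forall>i. 0 \<le> x $ i \<and> x $ i \<le> r $ i)"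
  by (auto simp: less_eq_vec_def)

lemma mem_lower_box: "x \<in> lower_box r \<longleftrightarrow> (\<forall>i. 0 \<le> x $ i \<and> x $ i < r $ i)"
  by (auto simp: lower_box_def mem_orthant strongly_less_def)

lemma le_K_iff: "le_K H x y \<longleftrightarrow> (\<forall>i. (i \<in> H \<longrightarrow> x $ i \<le> y $ i) \<and> (i \<notin> H \<longrightarrow> y $ i \<le> x $ i))"
  by (auto simp: le_K_def cone_K_def)

text \<open>Complementing \<open>H\<close> reverses the order while the hypotheses on
  \<open>T\<close> stay the same. Statements about coordinates in \<open>- H\<close> thus follow
  from those in \<open>H\<close> with \<open>x\<close> and \<open>y\<close> exchanged.\<close>

lemma less_K_Compl: "less_K (- H) x y \<longleftrightarrow> less_K H y x"
  by (auto simp: less_K_def le_K_iff)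

lemma typeK_competitive_Compl: "typeK_competitive (- H) Df \<longleftrightarrow> typeK_competitive H Df"
  by (auto simp: typeK_competitive_def)

lemma weakly_typeK_retrotone_on_Compl:
  "weakly_typeK_retrotone_on (- H) X T \<longleftrightarrow> weakly_typeK_retrotone_on H X T"
  unfolding weakly_typeK_retrotone_on_def less_K_Compl by auto

lemma typeK_retrotone_on_Compl: "typeK_retrotone_on (- H) X T \<longleftrightarrow> typeK_retrotone_on H X T"
  unfolding typeK_retrotone_on_def less_K_Compl by auto

text \<open>Coordinatewise, \<open>z\<close> lies between \<open>x\<close> and \<open>y\<close>, in
  an orientation that depends on the index; the maximum makes the upper bound independent of
  it.\<close>

lemma le_K_squeeze:
  assumes "le_K H x z" "le_K H z y" "\<And>i. 0 \<le> x $ i" "\<And>i. 0 \<le> y $ i"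
  shows "0 \<le> z $ i" "z $ i \<le> max (x $ i) (y $ i)"
  using assms unfolding le_K_iff by (smt (verit))+

lemma closed_face: "closed (face S)"
proof -
  have "face S = (\<Inter>j. {x. 0 \<le> x $ j} \<inter> (if j \<in> S then UNIV else {x. x $ j = 0}))"
    by (auto simp: face_def mem_orthant split: if_splits)
  also have "closed \<dots>"
    by (intro closed_INT closed_Int ballI) (auto intro!: closed_Collect_le closed_Collect_eq continuous_intros)
  finally show ?thesis .
qed

text \<open>The inequality \<open>a (Suc n) \<le> L * (a n / b n - a (Suc n) / b (Suc n))\<close> bounds \<open>a\<close> by the decrements of
  a decreasing nonnegative sequence.\<close>

lemma tendsto_zero_of_ratio_decrease:
  fixes a b u v :: "nat \<Rightarrow> real"
  assumes a: "\<And>n. a n = a (Suc n) * u n" and b: "\<And>n. b n = b (Suc n) * v n"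
    and gap: "\<And>n. c * (b (Suc n) - a (Suc n)) \<le> u n - v n"
    and ab: "\<And>n. 0 \<le> a n" "\<And>n. a n < b n"
    and v: "\<And>n. 0 < v n" "\<And>n. v n \<le> M" and c: "0 < c"
  shows "a \<longlonglongrightarrow> 0"
proof -
  define \<sigma> where "\<sigma> n = a n / b n" for n
  have bpos: "0 < b n" for n
    using ab[of n] by simp
  have sig: "0 \<le> \<sigma> n" "\<sigma> n < 1" for n
    using ab[of n] bpos[of n] by (auto simp: \<sigma>_def)
  have M: "0 < M"
    using v[of 0] by simp
  have step: "\<sigma> n - \<sigma> (Suc n) = \<sigma> (Suc n) * (u n - v n) / v n" for n
    using a[of n] b[of n] bpos[of "Suc n"] v(1)[of n] by (simp add: \<sigma>_def field_simps)
  \<comment> \<open>Multiplying the gap by \<open>\<sigma> (Suc n)\<close> turns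
    \<open>b - a\<close> into \<open>a * (1 - \<sigma>)\<close>, because \<open>\<sigma>\<close> is
    the quotient of \<open>a\<close> by \<open>b\<close>; dividing by \<open>v\<close> costs at most
    the factor \<open>M\<close>.\<close>
  have lower: "a (Suc n) * (c * (1 - \<sigma> (Suc n)) / M) \<le> \<sigma> n - \<sigma> (Suc n)" for n
  proof -
    have "0 \<le> c * (b (Suc n) - a (Suc n))"
      using c ab(2)[of "Suc n"] by simp
    then have "c * (b (Suc n) - a (Suc n)) / M \<le> (u n - v n) / v n"
      using gap[of n] v[of n] by (intro frac_le) auto
    then have "\<sigma> (Suc n) * (c * (b (Suc n) - a (Suc n)) / M) \<le> \<sigma> n - \<sigma> (Suc n)"
      unfolding step times_divide_eq_right[symmetric] by (intro mult_left_mono sig(1))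
    moreover have "\<sigma> (Suc n) * (c * (b (Suc n) - a (Suc n)) / M) = a (Suc n) * (c * (1 - \<sigma> (Suc n)) / M)"
      using bpos[of "Suc n"] M by (simp add: \<sigma>_def field_simps)
    ultimately show ?thesis by (simp only:)
  qed
  have dec: "\<sigma> (Suc n) \<le> \<sigma> n" for n
  proof -
    have "0 \<le> a (Suc n) * (c * (1 - \<sigma> (Suc n)) / M)"
      using ab(1) c M sig(2)[of "Suc n"] by simp
    with lower[of n] show ?thesis by simp
  qed
  have sig0: "\<sigma> n \<le> \<sigma> 0" for n
    by (induction n) (use dec order_trans in blast)+
  \<comment> \<open>Since \<open>\<sigma>\<close> decreases from a value below 1,
    \<open>1 - \<sigma> n\<close> never falls below \<open>1 - \<sigma> 0\<close>. Hence
    \<open>k\<close> bounds the factor of \<open>a (Suc n)\<close> in \<open>lower\<close> from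
    below, uniformly in \<open>n\<close>.\<close>
  define k where "k = c * (1 - \<sigma> 0) / M"
  have k: "0 < k"
    using c M sig(2)[of 0] by (simp add: k_def)
  have bound: "a (Suc n) \<le> (\<sigma> n - \<sigma> (Suc n)) / k" for n
  proof -
    have "k \<le> c * (1 - \<sigma> (Suc n)) / M"
      using c M sig0[of "Suc n"] by (simp add: k_def divide_right_mono)
    then have "a (Suc n) * k \<le> \<sigma> n - \<sigma> (Suc n)"
      using lower[of n] mult_left_mono[OF _ ab(1)[of "Suc n"]] by (meson order_trans)
    then show ?thesis
      using k by (simp add: field_simps)
  qed
  have "decseq \<sigma>"
    using dec by (simp add: decseq_Suc_iff)
  then obtain L where L: "\<sigma> \<longlonglongrightarrow> L"
    using decseq_convergent[of \<sigma> 0] sig(1) by blast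
  then have "(\<lambda>n. \<sigma> (Suc n)) \<longlonglongrightarrow> L"
    by (rule LIMSEQ_Suc)
  then have "(\<lambda>n. (\<sigma> n - \<sigma> (Suc n)) / k) \<longlonglongrightarrow> (L - L) / k"
    using L k by (intro tendsto_intros) auto
  then have "(\<lambda>n. a (Suc n)) \<longlonglongrightarrow> 0"
    by (intro tendsto_sandwich[OF _ _ tendsto_const, of 0 "\<lambda>n. a (Suc n)" sequentially])
       (auto simp: ab(1) bound)
  then show ?thesis
    by (rule LIMSEQ_imp_Suc)
qed

section \<open>Invariant cores of an injective map\<close>

lemma funpow_image_subset:
  assumes "T ` B \<subseteq> B"
  shows "(T ^^ n) ` B \<subseteq> B"
  by (induction n) (use assms in auto)

text \<open>Injectivity lets \<open>T\<close> pass through the intersection. This only shifts the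
  index by one, which is harmless because the images are nested.\<close>

lemma image_INT_funpow:
  assumes "inj_on T X" "B \<subseteq> X" "T ` B \<subseteq> B"
  shows "T ` (\<Inter>n. (T ^^ n) ` B) = (\<Inter>n. (T ^^ n) ` B)"
proof -
  have "T ` (\<Inter>n. (T ^^ n) ` B) = (\<Inter>n. T ` (T ^^ n) ` B)"
    using assms(1,2) funpow_image_subset[OF assms(3)]
    by (intro image_INT[where C = X and j = 0]) auto
  also have "\<dots> = (\<Inter>n. (T ^^ Suc n) ` B)"
    by (simp add: image_comp)
  also have "\<dots> = (\<Inter>n. (T ^^ n) ` B)"
  proof (intro equalityI INT_greatest)
    show "(\<Inter>n. (T ^^ Suc n) ` B) \<subseteq> (T ^^ n) ` B" for n
    proof (cases n)
      case 0
      have "(\<Inter>n. (T ^^ Suc n) ` B) \<subseteq> (T ^^ Suc 0) ` B"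
        by blast
      then show ?thesis
        using assms(3) 0 by simp
    next
      case (Suc m)
      then show ?thesis by blast
    qed
  qed blast
  finally show ?thesis .
qed

lemma compact_funpow_image:
  fixes T :: "'a::topological_space \<Rightarrow> 'a"
  assumes "compact B" "continuous_on B T" "T ` B \<subseteq> B"
  shows "compact ((T ^^ n) ` B)"
proof (induction n)
  case (Suc n)
  have "(T ^^ Suc n) ` B = T ` (T ^^ n) ` B"
    by (simp add: image_comp)
  then show ?case
    using Suc funpow_image_subset[OF assms(3)] continuous_on_subset[OF assms(2)]
    by (metis compact_continuous_image)
qed (simp add: assms)

lemma compact_INT_funpow:
  fixes T :: "'a::t2_space \<Rightarrow> 'a"
  assumes "compact B" "continuous_on B T" "T ` B \<subseteq> B"
  shows "compact (\<Inter>n. (T ^^ n) ` B)"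
proof -
  have "closed (\<Inter>n. (T ^^ n) ` B)"
    using compact_funpow_image[OF assms] by (intro closed_INT ballI compact_imp_closed)
  moreover have "(\<Inter>n. (T ^^ n) ` B) \<subseteq> (T ^^ 0) ` B"
    by blast
  then have "B \<inter> (\<Inter>n. (T ^^ n) ` B) = (\<Inter>n. (T ^^ n) ` B)"
    by auto
  ultimately show ?thesis
    using compact_Int_closed[OF assms(1)] by metis
qed

lemma INT_funpow_nonempty:
  fixes T :: "'a::heine_borel \<Rightarrow> 'a"
  assumes "compact B" "continuous_on B T" "T ` B \<subseteq> B" "B \<noteq> {}"
  shows "(\<Inter>n. (T ^^ n) ` B) \<noteq> {}"
proof (rule compact_nest)
  show "compact ((T ^^ n) ` B)" for n
    by (rule compact_funpow_image[OF assms(1-3)])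
  show "(T ^^ n) ` B \<noteq> {}" for n
    using assms(4) by simp
  show "(T ^^ n) ` B \<subseteq> (T ^^ m) ` B" if "m \<le> n" for m n
  proof -
    have "(T ^^ n) ` B = (T ^^ m) ` (T ^^ (n - m)) ` B"
      using that by (metis funpow_add image_comp le_add_diff_inverse)
    then show ?thesis
      using funpow_image_subset[OF assms(3)] by (simp add: image_mono)
  qed
qed

section \<open>Backward orbits\<close>

text \<open>The hypotheses gathered here are invariant under exchanging \<open>H\<close> with its
  complement, so each result about \<open>H\<close> has a mirror image for \<open>- H\<close>. The
  point \<open>q\<close> enters in a later locale.\<close>

locale kolmogorov_retrotone =
  fixes H :: "'n::finite set"
    and f T :: "real ^ 'n \<Rightarrow> real ^ 'n"
    and Df :: "real ^ 'n \<Rightarrow> real ^ 'n ^ 'n"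
    and r :: "real ^ 'n"
  assumes H_proper: "H \<noteq> {}" "H \<noteq> UNIV"
    and f_C1: "C1_on orthant f Df"
    and f_pos: "\<And>x i. x \<in> orthant \<Longrightarrow> f x $ i > 0"
    and T_def: "\<And>x. x \<in> orthant \<Longrightarrow> T x = (\<chi> i. x $ i * f x $ i)"
    and competitive: "typeK_competitive H Df"
    and r_pos: "0 \<lless> r"
    and T_box: "T ` {0..r} \<subseteq> lower_box r"
    and T_inj: "inj_on T {0..r}"
    and T_weakly_retrotone: "weakly_typeK_retrotone_on H {0..r} T"
begin

abbreviation g :: "real ^ 'n \<Rightarrow> real ^ 'n" where "g \<equiv> inv_step T r"

lemma kolmogorov_retrotone_Compl: "kolmogorov_retrotone (- H) f T Df r"
proof -
  have "- H \<noteq> {}" "- H \<noteq> UNIV"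
    using H_proper by auto
  then show ?thesis
    using f_C1 f_pos T_def competitive r_pos T_box T_inj T_weakly_retrotone
    by unfold_locales (simp_all add: typeK_competitive_Compl weakly_typeK_retrotone_on_Compl)
qed

lemma box_sub_orthant: "{0..r} \<subseteq> orthant" "lower_box r \<subseteq> {0..r}"
  by (auto simp: orthant_def) (auto simp: mem_lower_box less_eq_vec_def less_imp_le)

lemma T_nth: "x \<in> orthant \<Longrightarrow> T x $ i = x $ i * f x $ i"
  by (simp add: T_def)

lemma T_nth_eq_0: "x \<in> orthant \<Longrightarrow> T x $ i = 0 \<longleftrightarrow> x $ i = 0"
  using f_pos[of x i] by (simp add: T_nth)

lemma continuous_f: "continuous_on orthant f"
  using f_C1 unfolding C1_on_def by (intro has_derivative_continuous_on) blast

lemma continuous_T: "continuous_on orthant T"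
proof -
  have "continuous_on orthant (\<lambda>x. \<chi> i. x $ i * f x $ i)"
    using continuous_f by (intro continuous_intros)
  then show ?thesis
    by (rule continuous_on_eq) (simp add: T_def)
qed

lemma T_self: "T ` {0..r} \<subseteq> {0..r}"
  using T_box box_sub_orthant by blast

lemma compact_box: "compact {0..r}"
  by (metis interval_cbox compact_cbox)

lemma continuous_T_box: "B \<subseteq> {0..r} \<Longrightarrow> continuous_on B T"
  using continuous_T box_sub_orthant continuous_on_subset by blast

lemma g_T [simp]: "x \<in> {0..r} \<Longrightarrow> g (T x) = x"
  by (simp add: inv_step_def T_inj)

lemma T_g: "x \<in> T ` {0..r} \<Longrightarrow> T (g x) = x"
  by (simp add: inv_step_def f_inv_into_f)

lemma g_in_box: "x \<in> T ` {0..r} \<Longrightarrow> g x \<in> {0..r}"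
  unfolding inv_step_def by (rule inv_into_into)

text \<open>The core is its own image under \<open>T\<close>, so each of its points is
  \<open>T z\<close> with \<open>z\<close> again in the core, and \<open>g\<close> recovers this
  \<open>z\<close>.\<close>

lemma funpow_g_in_core:
  assumes B: "B \<subseteq> {0..r}" "T ` B \<subseteq> B" and x: "x \<in> (\<Inter>n. (T ^^ n) ` B)"
  shows "(g ^^ n) x \<in> (\<Inter>n. (T ^^ n) ` B)"
proof (induction n)
  case (Suc n)
  then obtain z where z: "z \<in> (\<Inter>n. (T ^^ n) ` B)" "(g ^^ n) x = T z"
    using image_INT_funpow[OF T_inj B] by blast
  then have "z \<in> (T ^^ 0) ` B" by blast
  then have "g (T z) = z"
    using B(1) by auto
  then show ?case using z by simp
qed (use x in simp)

lemma funpow_g_in_attractor: "x \<in> attractor T r \<Longrightarrow> (g ^^ n) x \<in> attractor T r"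
  using funpow_g_in_core[OF _ T_self] by (simp add: attractor_def)

lemma T_attractor: "T ` attractor T r = attractor T r"
  unfolding attractor_def by (rule image_INT_funpow[OF T_inj _ T_self]) simp

lemma attractor_sub_box: "attractor T r \<subseteq> {0..r}"
proof -
  have "attractor T r \<subseteq> (T ^^ 0) ` {0..r}"
    unfolding attractor_def by blast
  then show ?thesis by simp
qed

lemma attractor_sub_image: "attractor T r \<subseteq> T ` {0..r}"
  using T_attractor attractor_sub_box by blast

lemma attractor_sub_orthant: "attractor T r \<subseteq> orthant"
  using attractor_sub_box box_sub_orthant by blast

lemma attractor_sub_lower_box: "attractor T r \<subseteq> lower_box r"
  using attractor_sub_image T_box by blast

lemma attractor_step: "x \<in> attractor T r \<Longrightarrow> T (g x) = x" "x \<in> attractor T r \<Longrightarrow> g x \<in> attractor T r"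
  using attractor_sub_image T_g funpow_g_in_attractor[of x 1] by auto

lemma T_funpow_g: "inv_steps_defined T r x \<Longrightarrow> (T ^^ n) ((g ^^ n) x) = x"
proof (induction n)
  case (Suc n)
  have "T (g ((g ^^ n) x)) = (g ^^ n) x"
    using Suc.prems by (intro T_g) (simp add: inv_steps_defined_def)
  moreover have "(T ^^ Suc n) ((g ^^ Suc n) x) = (T ^^ n) (T (g ((g ^^ n) x)))"
    by (simp add: funpow_swap1)
  ultimately show ?case
    using Suc by simp
qed simp

text \<open>If all backward iterates exist, then \<open>x\<close> is the \<open>n\<close>-th forward
  image of its \<open>n\<close>-th backward iterate, a point of the box.\<close>

lemma attractor_iff: "x \<in> attractor T r \<longleftrightarrow> inv_steps_defined T r x"
proof
  show "inv_steps_defined T r x" if "x \<in> attractor T r"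
    using funpow_g_in_attractor[OF that] attractor_sub_image by (auto simp: inv_steps_defined_def)
next
  assume *: "inv_steps_defined T r x"
  have "x \<in> (T ^^ n) ` {0..r}" for n
  proof -
    have "(g ^^ n) x \<in> {0..r}"
      using * T_self unfolding inv_steps_defined_def by blast
    then show ?thesis
      using T_funpow_g[OF *] by (metis image_eqI)
  qed
  then show "x \<in> attractor T r"
    by (simp add: attractor_def)
qed

lemma repulsion_iff:
  "x \<in> repulsion_set T r \<longleftrightarrow> x \<in> attractor T r \<and> (\<lambda>n. (g ^^ n) x) \<longlonglongrightarrow> 0"
  using attractor_sub_orthant by (auto simp: repulsion_set_def attractor_iff)

text \<open>This is weak retrotonicity read along \<open>g\<close>. Its definition quantifies over
  \<open>i\<close> in \<open>H\<close> and \<open>j\<close> outside \<open>H\<close> together, so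
  extracting the part about \<open>i\<close> requires that some \<open>j\<close> exists.\<close>

lemma less_K_g:
  assumes "x \<in> T ` {0..r}" "y \<in> T ` {0..r}" "less_K H x y"
  shows "less_K H (g x) (g y)"
    and "i \<in> H \<Longrightarrow> x $ i < y $ i \<Longrightarrow> g x $ i < g y $ i"
  using T_weakly_retrotone[unfolded weakly_typeK_retrotone_on_def, rule_format,
      OF g_in_box[OF assms(1)] g_in_box[OF assms(2)]] H_proper assms
  by (auto simp: T_g)

lemma le_K_g:
  assumes "x \<in> T ` {0..r}" "y \<in> T ` {0..r}" "le_K H x y"
  shows "le_K H (g x) (g y)"
proof (cases "x = y")
  case True
  then show ?thesis by (simp add: le_K_iff)
next
  case False
  then show ?thesis
    using less_K_g(1)[OF assms(1,2)] assms(3) by (simp add: less_K_def)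
qed

section \<open>Order intervals in the attractor\<close>

text \<open>Extending \<open>T\<close> to an odd map in each coordinate makes invariance of domain applicable at the
  boundary of the orthant.\<close>

lemma image_lower_box_open:
  obtains U where "open U" "T ` lower_box r = U \<inter> orthant"
proof -
  define ab :: "real ^ 'n \<Rightarrow> real ^ 'n" where "ab x = (\<chi> i. \<bar>x $ i\<bar>)" for x
  define E :: "real ^ 'n \<Rightarrow> real ^ 'n" where "E x = (\<chi> i. x $ i * f (ab x) $ i)" for x
  define S where "S = {x :: real ^ 'n. \<forall>i. \<bar>x $ i\<bar> < r $ i}"
  have ab: "ab x \<in> orthant" for x
    by (simp add: ab_def mem_orthant)
  have ab_id: "ab x = x" if "x \<in> orthant" for x
    using that by (simp add: ab_def mem_orthant vec_eq_iff)
  have S_box: "ab x \<in> lower_box r" if "x \<in> S" for x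
    using that by (simp add: S_def ab_def mem_lower_box)
  have "S = (\<Inter>i. {x. \<bar>x $ i\<bar> < r $ i})"
    by (auto simp: S_def)
  moreover have "open \<dots>"
    by (intro open_INT ballI open_Collect_less continuous_intros) auto
  ultimately have "open S" by simp
  have "continuous_on UNIV ab"
    unfolding ab_def by (intro continuous_intros)
  then have "continuous_on UNIV (\<lambda>x. f (ab x))"
    using ab by (intro continuous_on_compose2[OF continuous_f]) auto
  then have "continuous_on UNIV E"
    unfolding E_def by (intro continuous_intros)
  then have cont: "continuous_on S E"
    using continuous_on_subset by blast
  \<comment> \<open>As \<open>f\<close> is positive, \<open>E\<close> acts as \<open>T\<close> on
    moduli and keeps signs. Moduli and signs together determine a point, so injectivity of
    \<open>T\<close> carries over to \<open>E\<close>.\<close>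
  have abE: "ab (E x) = T (ab x)" for x
    using f_pos[OF ab] by (simp add: vec_eq_iff T_def ab E_def) (simp add: ab_def abs_mult less_imp_le)
  have sgnE: "sgn (E x $ i) = sgn (x $ i)" for x i
    using f_pos[OF ab] by (simp add: E_def sgn_mult)
  have inj: "inj_on E S"
  proof (rule inj_onI)
    fix x y assume xy: "x \<in> S" "y \<in> S" "E x = E y"
    have "T (ab x) = T (ab y)"
      using xy(3) by (metis abE)
    then have "ab x = ab y"
      using T_inj S_box xy box_sub_orthant(2) by (meson inj_onD subsetD)
    then have "\<bar>x $ i\<bar> = \<bar>y $ i\<bar>" for i
      by (simp add: ab_def vec_eq_iff)
    moreover have "sgn (x $ i) = sgn (y $ i)" for i
      using xy(3) by (metis sgnE)
    ultimately show "x = y"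
      by (metis vec_eq_iff abs_mult_sgn)
  qed
  have "open (E ` S)"
    using invariance_of_domain cont \<open>open S\<close> inj by blast
  moreover have "T ` lower_box r = E ` S \<inter> orthant"
  proof (intro equalityI subsetI)
    fix y assume "y \<in> T ` lower_box r"
    then obtain x where x: "x \<in> lower_box r" "y = T x" by blast
    then have "x \<in> orthant" "x \<in> S"
      by (auto simp: mem_lower_box mem_orthant S_def)
    moreover have "E x = T x"
      using \<open>x \<in> orthant\<close> by (simp add: E_def ab_id T_def)
    moreover have "T x \<in> orthant"
      using x(1) T_self box_sub_orthant by blast
    ultimately show "y \<in> E ` S \<inter> orthant"
      using x by force
  next
    fix y assume "y \<in> E ` S \<inter> orthant"
    then obtain x where x: "x \<in> S" "y = E x" "y \<in> orthant" by blast
    then have "y = T (ab x)"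
      using abE ab_id by metis
    then show "y \<in> T ` lower_box r"
      using S_box x(1) by blast
  qed
  ultimately show ?thesis by (rule that)
qed

lemma interval_sub_image:
  assumes x: "x \<in> attractor T r" and y: "y \<in> attractor T r" and z: "le_K H x z" "le_K H z y"
  shows "z \<in> T ` {0..r}"
proof -
  define S where "S = {w. le_K H x w \<and> le_K H w y}"
  have xy_img: "x \<in> T ` {0..r}" "y \<in> T ` {0..r}"
    using x y attractor_sub_image by auto
  have nonneg: "0 \<le> x $ i" "0 \<le> y $ i" for i
    using x y attractor_sub_orthant by (auto simp: mem_orthant)
  have "S \<subseteq> orthant"
    using le_K_squeeze(1)[of H x _ y] nonneg by (simp add: S_def mem_orthant subset_iff)
  have conv: "convex S"
    unfolding convex_alt
  proof (intro ballI allI impI)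
    fix v w :: "real ^ 'n" and t :: real
    assume vw: "v \<in> S" "w \<in> S" and t: "0 \<le> t \<and> t \<le> 1"
    \<comment> \<open>Lower bounds of convex combinations are obtained from upper bounds by
      negation; both are needed since the order is reversed outside \<open>H\<close>.\<close>
    have "a \<le> (1 - t) * c + t * d" if "a \<le> c" "a \<le> d" for a c d :: real
      using convex_bound_le[of "-c" "-a" "-d" "1 - t" t] that t by simp
    moreover have "(1 - t) * c + t * d \<le> a" if "c \<le> a" "d \<le> a" for a c d :: real
      using convex_bound_le[of c a d "1 - t" t] that t by simp
    ultimately show "(1 - t) *\<^sub>R v + t *\<^sub>R w \<in> S"
      using vw by (simp add: S_def le_K_iff)
  qed
  obtain U where U: "open U" "T ` lower_box r = U \<inter> orthant"
    using image_lower_box_open by blast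
  \<comment> \<open>This makes the trace of the image relatively open in \<open>S\<close>. The point
    \<open>g w\<close> is squeezed between \<open>g x\<close> and \<open>g y\<close>, which lie in
    the attractor and hence strictly below \<open>r\<close>; so \<open>w\<close> is already in the
    image of \<open>lower_box r\<close>.\<close>
  have "S \<inter> T ` {0..r} = S \<inter> U"
  proof (intro equalityI subsetI)
    fix w assume w: "w \<in> S \<inter> T ` {0..r}"
    have "le_K H (g x) (g w)" "le_K H (g w) (g y)"
      using w le_K_g xy_img by (auto simp: S_def)
    moreover have "g x \<in> lower_box r" "g y \<in> lower_box r"
      using attractor_step(2) x y attractor_sub_lower_box by auto
    ultimately have "0 \<le> g w $ i \<and> g w $ i < r $ i" for i
      using le_K_squeeze[of H "g x" "g w" "g y" i] unfolding mem_lower_box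
      by (smt (verit, best))
    then have "g w \<in> lower_box r"
      by (simp add: mem_lower_box)
    then have "w \<in> T ` lower_box r"
      using w T_g by (metis IntD2 image_eqI)
    then show "w \<in> S \<inter> U"
      using w U by blast
  next
    fix w assume "w \<in> S \<inter> U"
    then show "w \<in> S \<inter> T ` {0..r}"
      using U \<open>S \<subseteq> orthant\<close> box_sub_orthant(2) by blast
  qed
  then have "openin (top_of_set S) (S \<inter> T ` {0..r})"
    using U(1) by auto
  moreover have "closed (T ` {0..r})"
    using compact_box continuous_T_box by (simp add: compact_continuous_image compact_imp_closed)
  then have "closedin (top_of_set S) (S \<inter> T ` {0..r})"
    by (rule closedin_closed_Int)
  moreover have "connected S"
    using conv by (rule convex_connected)
  moreover have "x \<in> S"
    using z by (auto simp: S_def le_K_iff intro: order_trans)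
  ultimately have "S \<inter> T ` {0..r} = S"
    using xy_img(1) unfolding connected_clopen by blast
  then show ?thesis
    using z by (auto simp: S_def)
qed

text \<open>Both ends stay in the attractor, so \<open>interval_sub_image\<close> applies afresh to
  each new interval. This guarantees that the next backward step of \<open>z\<close> is
  defined.\<close>

lemma interval_backward:
  assumes x: "x \<in> attractor T r" and y: "y \<in> attractor T r" and z: "le_K H x z" "le_K H z y"
  shows "le_K H ((g ^^ n) x) ((g ^^ n) z) \<and> le_K H ((g ^^ n) z) ((g ^^ n) y) \<and>
    (g ^^ n) z \<in> T ` {0..r}"
proof (induction n)
  case 0
  then show ?case
    using interval_sub_image assms by simp
next
  case (Suc n)
  have "(g ^^ m) x \<in> attractor T r" "(g ^^ m) y \<in> attractor T r" for m
    using x y funpow_g_in_attractor by auto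
  then have img: "(g ^^ m) x \<in> T ` {0..r}" "(g ^^ m) y \<in> T ` {0..r}"
    and att: "(g ^^ m) x \<in> attractor T r" "(g ^^ m) y \<in> attractor T r" for m
    using attractor_sub_image by auto
  have "le_K H ((g ^^ Suc n) x) ((g ^^ Suc n) z)" "le_K H ((g ^^ Suc n) z) ((g ^^ Suc n) y)"
    using le_K_g img Suc by auto
  then show ?case
    using interval_sub_image[OF att(1) att(2)] by blast
qed

text \<open>Each coordinate of the backward orbit of \<open>z\<close> is caught between 0 and the
  larger of the corresponding coordinates of the two ends, both of which vanish in the
  limit.\<close>

lemma interval_sub_repulsion:
  assumes x: "x \<in> repulsion_set T r" and y: "y \<in> repulsion_set T r"
    and z: "le_K H x z" "le_K H z y"
  shows "z \<in> repulsion_set T r"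
proof -
  have xy: "x \<in> attractor T r" "y \<in> attractor T r"
    and lim: "(\<lambda>n. (g ^^ n) x) \<longlonglongrightarrow> 0" "(\<lambda>n. (g ^^ n) y) \<longlonglongrightarrow> 0"
    using x y by (auto simp: repulsion_iff)
  note bw = interval_backward[OF xy z]
  have nonneg: "0 \<le> (g ^^ n) x $ i" "0 \<le> (g ^^ n) y $ i" for n i
  proof -
    have "(g ^^ n) x \<in> orthant" "(g ^^ n) y \<in> orthant"
      using xy funpow_g_in_attractor attractor_sub_orthant by blast+
    then show "0 \<le> (g ^^ n) x $ i" "0 \<le> (g ^^ n) y $ i"
      by (simp_all add: mem_orthant)
  qed
  have "(\<lambda>n. (g ^^ n) z $ i) \<longlonglongrightarrow> 0" for i
  proof (rule tendsto_sandwich[OF _ _ tendsto_const])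
    show "\<forall>\<^sub>F n in sequentially. 0 \<le> (g ^^ n) z $ i"
      using le_K_squeeze(1) bw nonneg by (intro always_eventually allI) blast
    show "\<forall>\<^sub>F n in sequentially. (g ^^ n) z $ i \<le> max ((g ^^ n) x $ i) ((g ^^ n) y $ i)"
      using le_K_squeeze(2) bw nonneg by (intro always_eventually allI) blast
    have "(\<lambda>n. max ((g ^^ n) x $ i) ((g ^^ n) y $ i)) \<longlonglongrightarrow> max ((0 :: real ^ 'n) $ i) ((0 :: real ^ 'n) $ i)"
      by (intro tendsto_max tendsto_vec_nth lim)
    then show "(\<lambda>n. max ((g ^^ n) x $ i) ((g ^^ n) y $ i)) \<longlonglongrightarrow> 0"
      by simp
  qed
  then have "(\<lambda>n. (g ^^ n) z) \<longlonglongrightarrow> 0"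
    by (intro vec_tendstoI) simp
  then show ?thesis
    using bw by (simp add: repulsion_iff attractor_iff inv_steps_defined_def)
qed

lemma typeK_convex_repulsion: "typeK_convex H (repulsion_set T r)"
  unfolding typeK_convex_def
proof (intro ballI impI subsetI)
  fix x y z
  assume x: "x \<in> repulsion_set T r" and y: "y \<in> repulsion_set T r"
    and "less_K H x y" and "z \<in> closed_segment x y"
  then have K: "le_K H x y"
    by (simp add: less_K_def)
  from \<open>z \<in> closed_segment x y\<close> obtain t where t: "0 \<le> t" "t \<le> 1" "z = (1 - t) *\<^sub>R x + t *\<^sub>R y"
    by (auto simp: in_segment)
  have between: "a \<le> (1 - t) * a + t * b \<and> (1 - t) * a + t * b \<le> b" if "a \<le> b" for a b :: real
    using mult_left_mono[OF that t(1)] mult_left_mono[OF that, of "1 - t"] t(2)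
    by (simp add: algebra_simps)
  have between': "b \<le> (1 - t) * a + t * b \<and> (1 - t) * a + t * b \<le> a" if "b \<le> a" for a b :: real
    using mult_left_mono[OF that t(1)] mult_left_mono[OF that, of "1 - t"] t(2)
    by (simp add: algebra_simps)
  show "z \<in> repulsion_set T r"
    using K between between' by (intro interval_sub_repulsion[OF x y]) (auto simp: le_K_iff t(3))
qed

section \<open>Backward extinction along ordered pairs\<close>

text \<open>Moving up in the \<open>K\<close>-order, every off-diagonal term in row \<open>i\<close>
  of the Jacobian contributes a nonpositive amount, while the diagonal term is negative, uniformly
  so by compactness of the box.\<close>

lemma growth_rate_gap:
  assumes i: "i \<in> H"
  obtains c where "0 < c"
    "\<And>x y. x \<in> {0..r} \<Longrightarrow> y \<in> {0..r} \<Longrightarrow> le_K H x y \<Longrightarrow> c * (y $ i - x $ i) \<le> f x $ i - f y $ i"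
proof -
  have "continuous_on {0..r} Df"
    using f_C1 box_sub_orthant(1) unfolding C1_on_def by (metis continuous_on_subset)
  then have cont: "continuous_on {0..r} (\<lambda>z. Df z $ i $ i)"
    by (intro continuous_intros)
  have "0 \<in> {0..r}"
    using r_pos unfolding mem_order_interval by (simp add: strongly_less_def less_imp_le)
  then have "{0..r} \<noteq> {}" by blast
  then obtain w where w: "w \<in> {0..r}" "\<And>z. z \<in> {0..r} \<Longrightarrow> Df z $ i $ i \<le> Df w $ i $ i"
    using continuous_attains_sup[OF compact_box _ cont] by blast
  \<comment> \<open>The largest diagonal entry over the box is attained at \<open>w\<close> and is
    negative.\<close>
  define c where "c = - Df w $ i $ i"
  have "w \<in> orthant"
    using w(1) box_sub_orthant by blast
  then have "0 < c"
    using competitive unfolding typeK_competitive_def c_def by force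
  moreover have "c * (y $ i - x $ i) \<le> f x $ i - f y $ i"
    if x: "x \<in> {0..r}" and y: "y \<in> {0..r}" and K: "le_K H x y" for x y
  proof -
    define p where "p t = x + t *\<^sub>R (y - x)" for t :: real
    have p_box: "p t \<in> {0..r}" if "t \<in> {0..1}" for t
    proof -
      have "p t = (1 - t) *\<^sub>R x + t *\<^sub>R y"
        by (simp add: p_def algebra_simps)
      moreover have "convex {0..r}"
        by (metis interval_cbox convex_box(1))
      ultimately show ?thesis
        using that x y by (simp add: convex_alt del: atLeastAtMost_iff) (auto simp: convex_alt)
    qed
    have der: "((\<lambda>t. f (p t) $ i) has_derivative (\<lambda>s. (Df (p t) *v (s *\<^sub>R (y - x))) $ i)) (at t within {0..1})"
      if t: "t \<in> {0..1}" for t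
    proof -
      have "p ` {0..1} \<subseteq> orthant"
        using p_box box_sub_orthant by blast
      moreover have "(f has_derivative (\<lambda>h. Df (p t) *v h)) (at (p t) within orthant)"
        using f_C1 p_box[OF t] box_sub_orthant(1) unfolding C1_on_def by blast
      ultimately have "(f has_derivative (\<lambda>h. Df (p t) *v h)) (at (p t) within p ` {0..1})"
        by (meson has_derivative_subset)
      moreover have "(p has_derivative (\<lambda>s. s *\<^sub>R (y - x))) (at t within {0..1})"
        unfolding p_def by (auto intro!: derivative_eq_intros)
      ultimately have "((\<lambda>t. f (p t)) has_derivative (\<lambda>s. Df (p t) *v (s *\<^sub>R (y - x)))) (at t within {0..1})"
        using has_derivative_in_compose by blast
      then show ?thesis
        by (rule bounded_linear.has_derivative[OF bounded_linear_vec_nth])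
    qed
    \<comment> \<open>Mean value theorem along the segment from \<open>x\<close> to
      \<open>y\<close>, which stays in the box by convexity.\<close>
    obtain t where t: "t \<in> {0..1}"
      "f (p 1) $ i - f (p 0) $ i = (Df (p t) *v ((1 - 0) *\<^sub>R (y - x))) $ i"
      using mvt_very_simple[of 0 1 "\<lambda>t. f (p t) $ i", OF _ der] by auto
    have pt: "p t \<in> {0..r}" "p t \<in> orthant"
      using p_box[OF t(1)] box_sub_orthant by auto
    have "(Df (p t) *v (y - x)) $ i = (\<Sum>j\<in>UNIV. Df (p t) $ i $ j * (y $ j - x $ j))"
      by (simp add: matrix_vector_mult_def)
    also have "\<dots> = Df (p t) $ i $ i * (y $ i - x $ i) +
        (\<Sum>j\<in>UNIV - {i}. Df (p t) $ i $ j * (y $ j - x $ j))"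
      by (rule sum.remove) auto
    \<comment> \<open>For \<open>j\<close> in \<open>H\<close> the entry is nonpositive and the
      increment nonnegative; for \<open>j\<close> outside \<open>H\<close> both signs flip.\<close>
    also have "(\<Sum>j\<in>UNIV - {i}. Df (p t) $ i $ j * (y $ j - x $ j)) \<le> 0"
    proof (rule sum_nonpos)
      fix j
      show "Df (p t) $ i $ j * (y $ j - x $ j) \<le> 0"
        using competitive pt(2) K i unfolding typeK_competitive_def le_K_iff
        by (cases "j \<in> H") (auto simp: mult_le_0_iff)
    qed
    also have "Df (p t) $ i $ i * (y $ i - x $ i) \<le> - c * (y $ i - x $ i)"
      using w(2)[OF pt(1)] K i by (intro mult_right_mono) (auto simp: c_def le_K_iff)
    finally show ?thesis
      using t(2) by (simp add: p_def)
  qed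
  ultimately show ?thesis by (rule that)
qed

text \<open>A forward step multiplies coordinate \<open>i\<close> by the growth rate
  \<open>f\<close>. So the two coordinate sequences obey the recursions of
  \<open>tendsto_zero_of_ratio_decrease\<close>, with the gap supplied by
  \<open>growth_rate_gap\<close>.\<close>

lemma backward_extinction:
  assumes x: "x \<in> attractor T r" and y: "y \<in> attractor T r" and K: "less_K H x y"
    and i: "i \<in> H" "x $ i \<noteq> y $ i"
  shows "(\<lambda>n. (g ^^ n) x $ i) \<longlonglongrightarrow> 0"
proof -
  have att: "(g ^^ n) x \<in> attractor T r" "(g ^^ n) y \<in> attractor T r" for n
    using x y funpow_g_in_attractor by auto
  then have img: "(g ^^ n) x \<in> T ` {0..r}" "(g ^^ n) y \<in> T ` {0..r}"
    and box: "(g ^^ n) x \<in> {0..r}" "(g ^^ n) y \<in> {0..r}"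
    and orth: "(g ^^ n) x \<in> orthant" "(g ^^ n) y \<in> orthant" for n
    using attractor_sub_image attractor_sub_box attractor_sub_orthant by blast+
  \<comment> \<open>Weak retrotonicity propagates both the order and the strict inequality in
    coordinate \<open>i\<close> backward.\<close>
  have ord: "less_K H ((g ^^ n) x) ((g ^^ n) y) \<and> (g ^^ n) x $ i < (g ^^ n) y $ i" for n
  proof (induction n)
    case 0
    then show ?case
      using K i by (force simp: less_K_def le_K_iff)
  next
    case (Suc n)
    then show ?case
      using less_K_g[OF img(1) img(2)] i(1) by auto
  qed
  obtain c where c: "0 < c" "\<And>x y. x \<in> {0..r} \<Longrightarrow> y \<in> {0..r} \<Longrightarrow> le_K H x y \<Longrightarrow>
      c * (y $ i - x $ i) \<le> f x $ i - f y $ i"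
    using growth_rate_gap[OF i(1)] by blast
  have "continuous_on {0..r} (\<lambda>z. f z $ i)"
    using continuous_f box_sub_orthant(1) by (intro continuous_intros) (metis continuous_on_subset)
  then obtain w where w: "\<And>z. z \<in> {0..r} \<Longrightarrow> f z $ i \<le> f w $ i"
    using continuous_attains_sup[OF compact_box] box(1) by (metis empty_iff)
  have rec: "(g ^^ n) z $ i = (g ^^ Suc n) z $ i * f ((g ^^ Suc n) z) $ i"
    if "z \<in> attractor T r" for z n
    using attractor_step[OF funpow_g_in_attractor[OF that, of n]] attractor_sub_orthant T_nth
    by (metis funpow.simps(2) o_apply subsetD)
  show ?thesis
  proof (rule tendsto_zero_of_ratio_decrease)
    show "(g ^^ n) x $ i = (g ^^ Suc n) x $ i * f ((g ^^ Suc n) x) $ i" for n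
      by (rule rec[OF x])
    show "(g ^^ n) y $ i = (g ^^ Suc n) y $ i * f ((g ^^ Suc n) y) $ i" for n
      by (rule rec[OF y])
    show "c * ((g ^^ Suc n) y $ i - (g ^^ Suc n) x $ i) \<le> f ((g ^^ Suc n) x) $ i - f ((g ^^ Suc n) y) $ i" for n
      using c(2) box ord[of "Suc n"] unfolding less_K_def by blast
    show "0 \<le> (g ^^ n) x $ i" for n
      using orth(1) by (simp add: mem_orthant)
    show "(g ^^ n) x $ i < (g ^^ n) y $ i" for n
      using ord by blast
    show "0 < f ((g ^^ Suc n) y) $ i" for n
      using f_pos orth(2) by blast
    show "f ((g ^^ Suc n) y) $ i \<le> f w $ i" for n
      using w box(2) by blast
    show "0 < c" by (rule c(1))
  qed
qed

text \<open>After one backward step, coordinate \<open>i\<close> is either strictly ordered, and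
  \<open>backward_extinction\<close> applies from there, or it vanishes and stays zero along the
  whole backward orbit of \<open>x\<close>.\<close>

lemma backward_extinction_retrotone:
  assumes retro: "typeK_retrotone_on H {0..r} T"
    and x: "x \<in> attractor T r" and y: "y \<in> attractor T r" and K: "less_K H x y"
  shows "(\<lambda>n. face_proj H ((g ^^ n) x)) \<longlonglongrightarrow> 0"
proof (rule vec_tendstoI)
  fix i
  have lim: "(\<lambda>n. (g ^^ n) x $ i) \<longlonglongrightarrow> 0" if i: "i \<in> H"
  proof (cases "g x $ i = g y $ i")
    case True
    have K': "less_K H (T (g x)) (T (g y))"
      using K x y by (simp add: attractor_step)
    have box: "g x \<in> {0..r}" "g y \<in> {0..r}"
      using x y g_in_box attractor_sub_image by auto
    \<comment> \<open>A nonzero value would force strict inequality in coordinate \<open>i\<close>,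
      against the equality of this case.\<close>
    then have "g y $ i = 0"
      using retro[unfolded typeK_retrotone_on_def, rule_format, OF box K'] i True H_proper(2) by auto
    then have zero: "x $ i = 0"
      using True T_nth_eq_0[of "g x" i] box box_sub_orthant(1) attractor_step(1)[OF x] by auto
    have "(g ^^ n) x $ i = 0" for n
    proof (induction n)
      case (Suc n)
      have "g ((g ^^ n) x) \<in> orthant" "T (g ((g ^^ n) x)) = (g ^^ n) x"
        using attractor_step[OF funpow_g_in_attractor[OF x]] attractor_sub_orthant by blast+
      then show ?case
        using T_nth_eq_0[of "g ((g ^^ n) x)" i] Suc by simp
    qed (simp add: zero)
    then show ?thesis by simp
  next
    case False
    have "(\<lambda>n. (g ^^ n) (g x) $ i) \<longlonglongrightarrow> 0"
      using x y K False attractor_sub_image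
      by (intro backward_extinction[OF _ _ _ i False]) (auto intro!: attractor_step less_K_g)
    then show ?thesis
      by (intro LIMSEQ_imp_Suc[of "\<lambda>n. (g ^^ n) x $ i"]) (simp add: funpow_swap1)
  qed
  then show "(\<lambda>n. face_proj H ((g ^^ n) x) $ i) \<longlonglongrightarrow> (0 :: real ^ 'n) $ i"
    by (cases "i \<in> H") (simp_all add: face_proj_def)
qed

end

section \<open>The repelling neighbourhood of the origin\<close>

locale kolmogorov_repelling = kolmogorov_retrotone H f T Df r
  for H :: "'n::finite set" and f T Df r +
  fixes q :: "real ^ 'n"
  assumes q_pos: "0 \<lless> q" and q_less: "q \<lless> r"
    and f_q: "\<And>x i. x \<in> {0..q} \<Longrightarrow> f x $ i > 1"
    and T_outside_q: "T ` ({0..r} - lower_box q) \<subseteq> {0..r} - lower_box q"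
    and q_covered: "{0..q} \<subseteq> T ` {0..q}"
begin

lemma q_box: "{0..q} \<subseteq> {0..r}"
  using q_less unfolding strongly_less_def subset_iff mem_order_interval
  by (metis less_imp_le order_trans)

text \<open>Leaving \<open>lower_box q\<close> means that some coordinate reaches that of
  \<open>q\<close>: a finite union of closed half-spaces.\<close>

lemma compact_outer: "compact ({0..r} - lower_box q)"
proof -
  have "{0..r} - lower_box q = {0..r} \<inter> (\<Union>i. {x. q $ i \<le> x $ i})"
    unfolding set_eq_iff Diff_iff Int_iff mem_order_interval mem_lower_box by (auto simp: not_less)
  moreover have "closed (\<Union>i. {x. q $ i \<le> x $ i})"
    by (intro closed_UN ballI closed_Collect_le continuous_intros) auto
  ultimately show ?thesis
    using compact_box by (simp add: compact_Int_closed)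
qed

lemma q_sub_image: "x \<in> {0..q} \<Longrightarrow> x \<in> T ` {0..r} \<and> g x \<in> {0..q} \<and> g x \<le> x"
proof -
  assume "x \<in> {0..q}"
  then obtain z where z: "z \<in> {0..q}" "x = T z"
    using q_covered by blast
  then have z': "z \<in> {0..r}" "z \<in> orthant"
    using q_box box_sub_orthant by auto
  have "z $ i * 1 \<le> z $ i * f z $ i" for i
    using f_q[OF z(1)] z(1) unfolding mem_order_interval by (intro mult_left_mono) (auto simp: less_imp_le)
  then have "z \<le> T z"
    using T_nth[OF z'(2)] by (simp add: less_eq_vec_def)
  then show ?thesis
    using z z' by auto
qed

lemma funpow_g_q: "x \<in> {0..q} \<Longrightarrow> (g ^^ n) x \<in> {0..q}"
  by (induction n) (use q_sub_image in auto)

lemma q_sub_repulsion: "{0..q} \<subseteq> repulsion_set T r"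
proof
  fix x assume x: "x \<in> {0..q}"
  note orbit = funpow_g_q[OF x]
  have att: "x \<in> attractor T r"
    using orbit q_sub_image by (auto simp: attractor_iff inv_steps_defined_def)
  have dec: "decseq (\<lambda>n. (g ^^ n) x $ i)" for i
    using q_sub_image[OF orbit] by (auto simp: decseq_Suc_iff less_eq_vec_def)
  have "\<exists>l. (\<lambda>n. (g ^^ n) x $ i) \<longlonglongrightarrow> l" for i
    using decseq_convergent[OF dec, of 0 i] orbit by (metis mem_order_interval)
  then obtain l where "\<And>i. (\<lambda>n. (g ^^ n) x $ i) \<longlonglongrightarrow> l i"
    by metis
  then have lim: "(\<lambda>n. (g ^^ n) x) \<longlonglongrightarrow> (\<chi> i. l i)"
    by (intro vec_tendstoI) simp
  define p where "p = (\<chi> i. l i)"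
  have "closed {0..q}"
    by (metis interval_cbox closed_cbox)
  then have p: "p \<in> {0..q}"
    using lim orbit unfolding p_def by (metis closed_sequentially)
  have p_orth: "p \<in> orthant"
    using p q_box box_sub_orthant by blast
  \<comment> \<open>The limit \<open>p\<close> of the decreasing orbit is fixed by \<open>T\<close>,
    by continuity. Each growth rate at \<open>p\<close> exceeds 1, so every coordinate of
    \<open>p\<close> must vanish.\<close>
  have "(\<lambda>n. T ((g ^^ Suc n) x)) \<longlonglongrightarrow> T p"
    using LIMSEQ_Suc[OF lim] p orbit unfolding p_def[symmetric]
    by (intro continuous_on_tendsto_compose[OF continuous_T_box[OF q_box]] always_eventually allI)
  moreover have "T ((g ^^ Suc n) x) = (g ^^ n) x" for n
    using q_sub_image[OF orbit] by (simp add: T_g)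
  ultimately have "T p = p"
    using lim LIMSEQ_unique unfolding p_def by fastforce
  then have "p $ i = 0" for i
    using T_nth[OF p_orth, of i] f_q[OF p, of i] by auto
  then have "p = 0"
    by (simp add: vec_eq_iff)
  then show "x \<in> repulsion_set T r"
    using att lim by (simp add: repulsion_iff p_def)
qed

section \<open>The outer set as complement of the repulsion set, and its parts on the faces\<close>

lemma repulsion_backward: "x \<in> attractor T r \<Longrightarrow> (g ^^ n) x \<in> repulsion_set T r \<Longrightarrow> x \<in> repulsion_set T r"
  unfolding repulsion_iff
  using LIMSEQ_offset[of "\<lambda>m. (g ^^ m) x" n 0] by (simp add: funpow_add)

text \<open>A backward orbit starting in the outer set stays in a compact set that misses
  \<open>0\<close>. Conversely, a backward orbit in the attractor that is not repelled never meets
  \<open>lower_box q\<close>, since that box lies in the repulsion set.\<close>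

lemma outer_set_eq: "outer_set T r q = attractor T r - repulsion_set T r"
proof (intro equalityI subsetI)
  fix x assume x: "x \<in> outer_set T r q"
  then have "x \<in> (T ^^ n) ` {0..r}" for n
    unfolding outer_set_def by blast
  then have "x \<in> attractor T r"
    by (simp add: attractor_def)
  moreover have "\<not> (\<lambda>n. (g ^^ n) x) \<longlonglongrightarrow> 0"
  proof
    assume "(\<lambda>n. (g ^^ n) x) \<longlonglongrightarrow> 0"
    moreover have "(g ^^ n) x \<in> (\<Inter>n. (T ^^ n) ` ({0..r} - lower_box q))" for n
      using x T_outside_q by (intro funpow_g_in_core) (auto simp: outer_set_def)
    then have "(g ^^ n) x \<in> (T ^^ 0) ` ({0..r} - lower_box q)" for n
      by blast
    then have "(g ^^ n) x \<in> {0..r} - lower_box q" for n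
      by simp
    ultimately have "0 \<in> {0..r} - lower_box q"
      using compact_imp_closed[OF compact_outer] by (metis closed_sequentially)
    then show False
      using q_pos by (simp add: mem_lower_box strongly_less_def)
  qed
  ultimately show "x \<in> attractor T r - repulsion_set T r"
    by (simp add: repulsion_iff)
next
  fix x assume x: "x \<in> attractor T r - repulsion_set T r"
  have "x \<in> (T ^^ n) ` ({0..r} - lower_box q)" for n
  proof -
    have "(g ^^ n) x \<notin> repulsion_set T r"
      using x repulsion_backward by blast
    moreover have "lower_box q \<subseteq> {0..q}"
      unfolding subset_iff mem_lower_box mem_order_interval by (metis less_imp_le)
    ultimately have "(g ^^ n) x \<notin> lower_box q"
      using q_sub_repulsion by blast
    moreover have "(g ^^ n) x \<in> {0..r}"
      using x funpow_g_in_attractor attractor_sub_box by blast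
    moreover have "(T ^^ n) ((g ^^ n) x) = x"
      using x T_funpow_g attractor_iff by blast
    ultimately show ?thesis
      by (metis DiffI image_eqI)
  qed
  then show "x \<in> outer_set T r q"
    by (simp add: outer_set_def)
qed

lemma compact_outer_set: "compact (outer_set T r q)"
  unfolding outer_set_def
  by (intro compact_INT_funpow compact_outer continuous_T_box T_outside_q) auto

lemma T_outer_set: "T ` outer_set T r q = outer_set T r q"
  unfolding outer_set_def by (rule image_INT_funpow[OF T_inj _ T_outside_q]) auto

text \<open>\<open>T\<close> preserves zero coordinates, so the part of the outer region on the face
  is compact and forward invariant. Its core is nonempty, and as a closed set invariant under
  \<open>g\<close> it contains the alpha limits of its points.\<close>

lemma outer_face_nonempty:
  assumes "S \<noteq> {}"
  shows "outer_face T r q S \<noteq> {}"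
proof -
  define B where "B = ({0..r} - lower_box q) \<inter> face S"
  define I where "I = (\<Inter>n. (T ^^ n) ` B)"
  have B: "B \<subseteq> {0..r}"
    by (auto simp: B_def)
  have cB: "compact B"
    unfolding B_def by (intro compact_Int_closed compact_outer closed_face)
  have TB: "T ` B \<subseteq> B"
  proof
    fix y assume "y \<in> T ` B"
    then obtain x where x: "x \<in> B" "y = T x" by blast
    then have "y \<in> {0..r} - lower_box q"
      using T_outside_q unfolding B_def by blast
    moreover have "y \<in> face S"
      using x calculation box_sub_orthant(1) T_nth_eq_0 unfolding B_def face_def by auto
    ultimately show "y \<in> B"
      by (simp add: B_def)
  qed
  obtain s where s: "s \<in> S"
    using assms by blast
  \<comment> \<open>This point lies on the face, and its coordinate \<open>s\<close> equals that of
    \<open>q\<close>, which keeps it outside \<open>lower_box q\<close>.\<close>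
  have "axis s (q $ s) \<in> B"
  proof -
    have "0 < q $ i \<and> q $ i < r $ i" for i
      using q_pos q_less by (simp add: strongly_less_def)
    moreover have "0 \<le> r $ i" for i
      using calculation[of i] by linarith
    ultimately show ?thesis
      using s unfolding B_def Diff_iff Int_iff mem_order_interval mem_lower_box face_def mem_Collect_eq mem_orthant
      by (auto simp: axis_def less_imp_le intro!: exI[of _ s])
  qed
  then have "I \<noteq> {}"
    unfolding I_def using cB TB continuous_T_box[OF B] by (intro INT_funpow_nonempty) auto
  then obtain x where x: "x \<in> I" by blast
  have "I \<subseteq> (T ^^ 0) ` B"
    unfolding I_def by blast
  then have I_sub: "I \<subseteq> outer_set T r q \<inter> face S"
    unfolding I_def outer_set_def B_def by auto
  have "closed I"
    unfolding I_def by (intro compact_imp_closed compact_INT_funpow cB TB continuous_T_box[OF B])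
  moreover have "(g ^^ m) x \<in> I" for m
    using funpow_g_in_core[OF B TB] x by (simp add: I_def)
  ultimately have "closure {(g ^^ m) x | m. m \<ge> 0} \<subseteq> I"
    by (intro closure_minimal) auto
  then have "alpha_limit T r x \<subseteq> I"
    unfolding alpha_limit_def by blast
  then show ?thesis
    using I_sub x unfolding outer_face_def by blast
qed

text \<open>The repulsion set is the union of the forward images of \<open>{0..q}\<close>, which are
  connected and share the fixed point \<open>0\<close>.\<close>

lemma connected_repulsion: "connected (repulsion_set T r)"
proof -
  have zero: "0 \<in> {0..q}"
    using q_pos unfolding mem_order_interval by (simp add: strongly_less_def less_imp_le)
  have T0: "(T ^^ n) 0 = 0" for n
  proof (induction n)
    case (Suc n)
    have "T 0 = 0"
      using T_def[of 0] by (simp add: mem_orthant vec_eq_iff)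
    then show ?case using Suc by simp
  qed simp
  have eq: "repulsion_set T r = (\<Union>n. (T ^^ n) ` {0..q})"
  proof (intro equalityI subsetI)
    fix x assume "x \<in> repulsion_set T r"
    then have x: "x \<in> attractor T r" "x \<notin> outer_set T r q"
      using outer_set_eq by (auto simp: repulsion_iff)
    \<comment> \<open>As \<open>x\<close> misses the \<open>n\<close>-th image of the outer region,
      its \<open>n\<close>-th backward iterate must lie in \<open>lower_box q\<close>.\<close>
    then obtain n where n: "x \<notin> (T ^^ n) ` ({0..r} - lower_box q)"
      by (auto simp: outer_set_def)
    have "(T ^^ n) ((g ^^ n) x) = x" "(g ^^ n) x \<in> {0..r}"
      using x T_funpow_g attractor_iff funpow_g_in_attractor attractor_sub_box by blast+
    then have "(g ^^ n) x \<in> lower_box q"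
      using n by (metis DiffI image_eqI)
    then have "(g ^^ n) x \<in> {0..q}"
      unfolding mem_lower_box mem_order_interval by (metis less_imp_le)
    then show "x \<in> (\<Union>n. (T ^^ n) ` {0..q})"
      using \<open>(T ^^ n) ((g ^^ n) x) = x\<close> by (metis UNIV_I UN_iff image_eqI)
  next
    fix x assume "x \<in> (\<Union>n. (T ^^ n) ` {0..q})"
    then obtain n z where z: "z \<in> {0..q}" "x = (T ^^ n) z" by blast
    have "(T ^^ n) z \<in> repulsion_set T r" for n
    proof (induction n)
      case 0
      then show ?case
        using z q_sub_repulsion by auto
    next
      case (Suc n)
      let ?w = "(T ^^ n) z"
      have "?w \<in> attractor T r"
        using Suc by (simp add: repulsion_iff)
      then have "T ?w \<in> attractor T r" "g (T ?w) = ?w"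
        using T_attractor attractor_sub_box g_T by blast+
      then show ?case
        using repulsion_backward[of "T ?w" 1] Suc by simp
    qed
    then show "x \<in> repulsion_set T r"
      using z by simp
  qed
  have conn: "connected ((T ^^ n) ` {0..q})" for n
  proof (induction n)
    case 0
    have "convex {0..q}"
      by (metis interval_cbox convex_box(1))
    then show ?case
      by (simp add: convex_connected)
  next
    case (Suc n)
    have "(T ^^ n) ` {0..q} \<subseteq> {0..r}"
      using q_box funpow_image_subset[OF T_self] by blast
    then have "connected (T ` (T ^^ n) ` {0..q})"
      by (intro connected_continuous_image continuous_T_box Suc)
    then show ?case
      by (simp add: image_comp)
  qed
  have "0 \<in> (\<Inter>n. (T ^^ n) ` {0..q})"
    using zero T0 by (metis INT_I image_eqI)
  then have "\<Inter> (range (\<lambda>n. (T ^^ n) ` {0..q})) \<noteq> {}"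
    by blast
  then show ?thesis
    unfolding eq using conn by (intro connected_Union) blast+
qed

end

section \<open>Assembly of the statements (a) to (d)\<close>

theorem proposition3:
  fixes H :: "'n::finite set"
    and f T :: "real ^ 'n \<Rightarrow> real ^ 'n"
    and Df :: "real ^ 'n \<Rightarrow> real ^ 'n ^ 'n"
    and r q :: "real ^ 'n"
  assumes dim: "CARD('n) \<ge> 2" "1 \<le> card H" "card H < CARD('n)"
    and f_into: "f ` orthant \<subseteq> orthant"
    and f_C1: "C1_on orthant f Df"
    and f_pos: "\<And>x i. x \<in> orthant \<Longrightarrow> f x $ i > 0"
    and T_def: "\<And>x. x \<in> orthant \<Longrightarrow> T x = (\<chi> i. x $ i * f x $ i)"
    and competitive: "typeK_competitive H Df"
    and f_0: "\<And>i. f 0 $ i > 1"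
    and dissipative: "dissipative T"
    and r_pos: "0 \<lless> r"
    and r_absorbs: "\<And>x. x \<in> orthant \<Longrightarrow> \<forall>\<^sub>F n in sequentially. (T ^^ n) x \<in> {0..r}"
    and T_box: "T ` {0..r} \<subseteq> lower_box r"
    and T_homeo: "\<exists>g. homeomorphism {0..r} (T ` {0..r}) T g"
    and T_weakly_retrotone: "weakly_typeK_retrotone_on H {0..r} T"
    and q_pos: "0 \<lless> q" and q_less: "q \<lless> r"
    and f_q: "\<And>x i. x \<in> {0..q} \<Longrightarrow> f x $ i > 1"
    and T_outside_q: "T ` ({0..r} - lower_box q) \<subseteq> {0..r} - lower_box q"
    and q_covered: "{0..q} \<subseteq> T ` {0..q}"
  shows
    "(compact (outer_set T r q) \<and> T ` outer_set T r q = outer_set T r q \<and>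
      outer_set T r q = attractor T r - repulsion_set T r \<and>
      outer_set T r q = outer_face T r q H \<union> outer_mid T r q H \<union> outer_face T r q (- H) \<and>
      outer_face T r q H \<noteq> {} \<and> outer_face T r q (- H) \<noteq> {})
     \<and>
     (connected (repulsion_set T r) \<and> typeK_convex H (repulsion_set T r))
     \<and>
     (\<forall>x\<in>attractor T r. \<forall>y\<in>attractor T r. less_K H x y \<longrightarrow>
        (\<forall>i\<in>H. x $ i \<noteq> y $ i \<longrightarrow> (\<lambda>n. (inv_step T r ^^ n) x $ i) \<longlonglongrightarrow> 0) \<and>
        (\<forall>j\<in>- H. x $ j \<noteq> y $ j \<longrightarrow> (\<lambda>n. (inv_step T r ^^ n) y $ j) \<longlonglongrightarrow> 0))
     \<and>
     (typeK_retrotone_on H {0..r} T \<longrightarrow>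
       (\<forall>x\<in>attractor T r. \<forall>y\<in>attractor T r. less_K H x y \<longrightarrow>
          (\<lambda>n. face_proj H ((inv_step T r ^^ n) x)) \<longlonglongrightarrow> 0 \<and>
          (\<lambda>n. face_proj (- H) ((inv_step T r ^^ n) y)) \<longlonglongrightarrow> 0))"
proof -
  have H: "H \<noteq> {}" "H \<noteq> UNIV"
    using dim by auto
  have inj: "inj_on T {0..r}"
    using T_homeo by (metis homeomorphism_def inj_on_inverseI)
  interpret kolmogorov_repelling H f T Df r q
    using H f_C1 f_pos T_def competitive r_pos T_box inj T_weakly_retrotone q_pos q_less f_q
      T_outside_q q_covered
    by unfold_locales
  \<comment> \<open>The mirrored copy, applied to the pair \<open>y\<close>, \<open>x\<close>,
    yields the conclusions for the coordinates in \<open>- H\<close>.\<close>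
  interpret opp: kolmogorov_retrotone "- H" f T Df r
    by (rule kolmogorov_retrotone_Compl)
  have "outer_set T r q = outer_face T r q H \<union> outer_mid T r q H \<union> outer_face T r q (- H)"
    by (auto simp: outer_mid_def outer_face_def)
  moreover have "- H \<noteq> {}"
    using H(2) by auto
  ultimately have a: "compact (outer_set T r q) \<and> T ` outer_set T r q = outer_set T r q \<and>
      outer_set T r q = attractor T r - repulsion_set T r \<and>
      outer_set T r q = outer_face T r q H \<union> outer_mid T r q H \<union> outer_face T r q (- H) \<and>
      outer_face T r q H \<noteq> {} \<and> outer_face T r q (- H) \<noteq> {}"
    using compact_outer_set T_outer_set outer_set_eq outer_face_nonempty H(1) by metis
  have opp: "less_K (- H) y x" if "less_K H x y" for x y
    using that by (simp add: less_K_Compl)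
  have opp_retro: "typeK_retrotone_on (- H) {0..r} T" if "typeK_retrotone_on H {0..r} T"
    using that by (simp add: typeK_retrotone_on_Compl)
  show ?thesis
  proof (intro conjI[OF a] conjI connected_repulsion typeK_convex_repulsion ballI impI)
    fix x y
    assume x: "x \<in> attractor T r" and y: "y \<in> attractor T r" and K: "less_K H x y"
    show "(\<lambda>n. (g ^^ n) x $ i) \<longlonglongrightarrow> 0" if "i \<in> H" "x $ i \<noteq> y $ i" for i
      using backward_extinction x y K that by blast
    show "(\<lambda>n. (g ^^ n) y $ j) \<longlonglongrightarrow> 0" if "j \<in> - H" "x $ j \<noteq> y $ j" for j
      using opp.backward_extinction[OF y x opp[OF K] that(1)] that(2) by simp
    assume retro: "typeK_retrotone_on H {0..r} T"
    show "(\<lambda>n. face_proj H ((g ^^ n) x)) \<longlonglongrightarrow> 0"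
      by (rule backward_extinction_retrotone[OF retro x y K])
    show "(\<lambda>n. face_proj (- H) ((g ^^ n) y)) \<longlonglongrightarrow> 0"
      by (rule opp.backward_extinction_retrotone[OF opp_retro[OF retro] y x opp[OF K]])
  qed
qed

end
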